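(* Let $n\ge4$ be even and let $F$ be a field of characteristic $\ne2$. Let $L_{n+1}$ be the simple $(n+1)$-dimensional $n$-Lie algebra over $F$ with basis $e_1,\dots,e_{n+1}$ and $[e_1,\dots,\widehat{e}_i,\dots,e_{n+1}]=(-1)^{n+i+1}e_i$ for $1\le i\le n+1$. Then the natural map $i\colon L_{n+1}\to U(L_{n+1})$ to the universal associative enveloping algebra is injective.
   Context: An $n$-Lie algebra is a vector space over a field of characteristic $\neq2$ with a multilinear alternating operation $[z_1,\dots,z_n]$ (permuting arguments by $\sigma$ multiplies by the sign $\epsilon(\sigma)$) satisfying $[[z_1,\dots,z_n],w_2,\dots,w_n]=\sum_{i=1}^n[z_1,\dots,[z_i,w_2,\dots,w_n],\dots,z_n]$. A hat means the entry is omitted. $\mathrm{alt}(z_1,\dots,z_n)=\sum_{\sigma\in S_n}\epsilon(\sigma)z_{\sigma(1)}\cdots z_{\sigma(n)}$. Universal associative envelope: let $I$ be the two-sided ideal of the free unital associative algebra $F\langle x_1,\dots,x_{n+1}\rangle$ generated by the elements $$G_i=(-1)^{\lfloor n/2\rfloor}\big(\mathrm{alt}(x_1,\dots,\widehat{x}_i,\dots,x_{n+1})-(-1)^{n+i+1}x_i\big),\quad 1\le i\le n+1.$$ Then $U(L_{n+1})=F\langle x_1,\dots,x_{n+1}\rangle/I$, with natural linear map $i\colon L_{n+1}\to U(L_{n+1})$, $e_k\mapsto x_k+I$; it is universal among linear maps $j\colon L_{n+1}\to A$ to unital associative algebras with $j([z_1,\dots,z_n])=\mathrm{alt}(j(z_1),\dots,j(z_n))$.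 *)

theory Defs
  imports
    Complex_Main
    "HOL-Library.Poly_Mapping"
    "HOL-Combinatorics.Permutations"
    "HOL-Algebra.QuotRing"
begin

section \<open>$n$-Lie algebras\<close>

text \<open>
  The bracket takes a list of arguments; only its values on lists of length \<open>n\<close> matter.
  \<^term>\<open>permute_list \<sigma> zs\<close> is the list whose \<open>i\<close>-th entry is \<^term>\<open>zs ! \<sigma> i\<close>.
\<close>

locale n_Lie_algebra = vector_space scale
  for scale :: "'f::field \<Rightarrow> 'v::ab_group_add \<Rightarrow> 'v" +
  fixes n :: nat and bracket :: "'v list \<Rightarrow> 'v"
  assumes char_ne_2: "CHAR('f) \<noteq> 2"
    and multilinear: "length zs = n \<Longrightarrow> k < n \<Longrightarrow>
          Vector_Spaces.linear scale scale (\<lambda>v. bracket (zs[k := v]))"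
    and alternating: "length zs = n \<Longrightarrow> \<sigma> permutes {..<n} \<Longrightarrow>
          bracket (permute_list \<sigma> zs) = scale (of_int (sign \<sigma>)) (bracket zs)"
    and derivation: "length zs = n \<Longrightarrow> length ws = n - 1 \<Longrightarrow>
          bracket (bracket zs # ws) = (\<Sum>k<n. bracket (zs[k := bracket (zs ! k # ws)]))"

definition omit :: "nat \<Rightarrow> nat \<Rightarrow> (nat \<Rightarrow> 'a) \<Rightarrow> 'a list" where
  "omit n i z = map z (filter (\<lambda>j. j \<noteq> i) [1..<n + 2])"

text \<open>
  An $n$-Lie algebra with basis $e_1,\dots,e_{n+1}$ and the bracket table of $L_{n+1}$. By
  multilinearity and the alternating law the table determines the bracket, hence the algebra up to
  isomorphism; its simplicity is a consequence of the table and not a further condition.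
\<close>

locale L_algebra = n_Lie_algebra scale n bracket
  for scale :: "'f::field \<Rightarrow> 'v::ab_group_add \<Rightarrow> 'v" and n :: nat and bracket :: "'v list \<Rightarrow> 'v" +
  fixes e :: "nat \<Rightarrow> 'v"
  assumes basis_inj: "inj_on e {1..n+1}"
    and basis_independent: "independent (e ` {1..n+1})"
    and basis_span: "span (e ` {1..n+1}) = UNIV"
    and bracket_table: "i \<in> {1..n+1} \<Longrightarrow>
          bracket (omit n i e) = scale ((-1) ^ (n + i + 1)) (e i)"


section \<open>The free associative algebra\<close>

text \<open>
  Words form a monoid under concatenation, written additively, so that the multiplication of
  \<open>'a word0 \<Rightarrow>\<^sub>0 'f\<close> provided by the library is that of the free unital associative algebra on the
  alphabet \<open>'a\<close>. The wrapper type avoids an arithmetic type class instance on plain lists.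
\<close>

datatype 'a word0 = Word (letters: "'a list")

instantiation word0 :: (type) monoid_add
begin

definition zero_word0 :: "'a word0" where "0 = Word []"

definition plus_word0 :: "'a word0 \<Rightarrow> 'a word0 \<Rightarrow> 'a word0" where
  "u + v = Word (letters u @ letters v)"

instance
  by standard (simp_all add: zero_word0_def plus_word0_def)

end

type_synonym 'f free_alg = "nat word0 \<Rightarrow>\<^sub>0 'f"

definition gen :: "nat \<Rightarrow> 'f::field free_alg" where
  "gen i = Poly_Mapping.single (Word [i]) 1"

definition of_scalar :: "'f::field \<Rightarrow> 'f free_alg" where
  "of_scalar c = Poly_Mapping.single 0 c"

text \<open>The algebra $F\langle x_1,\dots,x_m\rangle$: noncommutative polynomials whose words only use
  the letters $1,\dots,m$.\<close>

definition free_algebra :: "nat \<Rightarrow> 'f::field free_alg ring" where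
  "free_algebra m =
     \<lparr>carrier = {p. \<forall>w \<in> Poly_Mapping.keys p. set (letters w) \<subseteq> {1..m}},
      mult = (*), one = 1, zero = 0, add = (+)\<rparr>"


section \<open>The universal associative envelope\<close>

definition alt :: "'a::ring_1 list \<Rightarrow> 'a" where
  "alt zs = (\<Sum>\<sigma> | \<sigma> permutes {..<length zs}. of_int (sign \<sigma>) * prod_list (permute_list \<sigma> zs))"

definition env_rel :: "nat \<Rightarrow> nat \<Rightarrow> 'f::field free_alg" where
  "env_rel n i = (-1) ^ (n div 2) * (alt (omit n i gen) - (-1) ^ (n + i + 1) * gen i)"

definition env_ideal :: "nat \<Rightarrow> 'f::field free_alg set" where
  "env_ideal n = Idl\<^bsub>free_algebra (n + 1)\<^esub> (env_rel n ` {1..n+1})"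

definition univ_env :: "nat \<Rightarrow> 'f::field free_alg set ring" where
  "univ_env n = free_algebra (n + 1) Quot env_ideal n"

text \<open>The linear extension of $e_k \mapsto x_k + I$, with $I$ the ideal above.\<close>

definition natural_map ::
  "('f::field \<Rightarrow> 'v::ab_group_add \<Rightarrow> 'v) \<Rightarrow> nat \<Rightarrow> (nat \<Rightarrow> 'v) \<Rightarrow> 'v \<Rightarrow> 'f free_alg set" where
  "natural_map scale n e v =
     env_ideal n +>\<^bsub>free_algebra (n + 1)\<^esub>
       (\<Sum>k = 1..n+1. of_scalar (module.representation scale (e ` {1..n+1}) v (e k)) * gen k)"


section \<open>Basic facts\<close>

lemma letters_plus [simp]: "letters (u + v) = letters u @ letters v"
  by (simp add: plus_word0_def)

lemma letters_zero [simp]: "letters 0 = []"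
  by (simp add: zero_word0_def)

lemma carrier_free_algebra:
  "p \<in> carrier (free_algebra m) \<longleftrightarrow> (\<forall>w \<in> Poly_Mapping.keys p. set (letters w) \<subseteq> {1..m})"
  by (simp add: free_algebra_def)

lemma free_algebra_simps [simp]:
  "x \<otimes>\<^bsub>free_algebra m\<^esub> y = x * y" "x \<oplus>\<^bsub>free_algebra m\<^esub> y = x + y"
  "\<one>\<^bsub>free_algebra m\<^esub> = 1" "\<zero>\<^bsub>free_algebra m\<^esub> = 0"
  by (simp_all add: free_algebra_def)

lemma carrier_add: "p \<in> carrier (free_algebra m) \<Longrightarrow> q \<in> carrier (free_algebra m)
    \<Longrightarrow> p + q \<in> carrier (free_algebra m)"
  using Poly_Mapping.keys_add[of p q] by (fastforce simp: carrier_free_algebra)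

lemma carrier_uminus: "p \<in> carrier (free_algebra m) \<Longrightarrow> - p \<in> carrier (free_algebra m)"
  by (simp add: carrier_free_algebra)

lemma carrier_diff: "p \<in> carrier (free_algebra m) \<Longrightarrow> q \<in> carrier (free_algebra m)
    \<Longrightarrow> p - q \<in> carrier (free_algebra m)"
  using carrier_add[of p m "- q"] carrier_uminus by auto

lemma carrier_mult: "p \<in> carrier (free_algebra m) \<Longrightarrow> q \<in> carrier (free_algebra m)
    \<Longrightarrow> p * q \<in> carrier (free_algebra m)"
  using Poly_Mapping.keys_mult[of p q] by (fastforce simp: carrier_free_algebra)

lemma carrier_0: "0 \<in> carrier (free_algebra m)"
  by (simp add: carrier_free_algebra)

lemma carrier_of_scalar: "of_scalar c \<in> carrier (free_algebra m)"
  by (simp add: carrier_free_algebra of_scalar_def)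

lemma of_scalar_1: "of_scalar 1 = 1"
  by (simp add: of_scalar_def)

lemma carrier_1: "1 \<in> carrier (free_algebra m)"
  using carrier_of_scalar[of 1] by (simp add: of_scalar_1)

lemma carrier_gen: "i \<in> {1..m} \<Longrightarrow> gen i \<in> carrier (free_algebra m)"
  by (simp add: carrier_free_algebra gen_def)

lemma carrier_sum: "(\<And>i. i \<in> A \<Longrightarrow> f i \<in> carrier (free_algebra m))
    \<Longrightarrow> sum f A \<in> carrier (free_algebra m)"
  by (induction A rule: infinite_finite_induct) (auto intro: carrier_0 carrier_add)

lemma carrier_prod_list: "set ps \<subseteq> carrier (free_algebra m) \<Longrightarrow> prod_list ps \<in> carrier (free_algebra m)"
  by (induction ps) (auto intro: carrier_1 carrier_mult)

lemma carrier_of_int: "of_int k \<in> carrier (free_algebra m)"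
  by (induction k rule: int_induct[where k = 0])
    (auto intro: carrier_0 carrier_1 carrier_add carrier_diff)

lemma ring_free_algebra: "ring (free_algebra m)"
proof (rule ringI)
  show "abelian_group (free_algebra m)"
    by (rule abelian_groupI)
      (auto intro: carrier_add carrier_0 simp: algebra_simps
        intro!: bexI[where x = "- x" for x, OF _ carrier_uminus])
  show "Group.monoid (free_algebra m)"
    by (rule monoidI) (auto intro: carrier_mult carrier_1 simp: algebra_simps)
qed (auto simp: algebra_simps)

lemma carrier_alt:
  assumes "set zs \<subseteq> carrier (free_algebra m)"
  shows "alt zs \<in> carrier (free_algebra m)"
proof -
  have "set (permute_list \<sigma> zs) \<subseteq> carrier (free_algebra m)" if "\<sigma> permutes {..<length zs}" for \<sigma>
    using assms set_permute_list[OF that] by simp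
  then show ?thesis
    unfolding alt_def by (intro carrier_sum carrier_mult carrier_of_int carrier_prod_list) simp
qed

lemma carrier_env_rel:
  assumes "i \<in> {1..n+1}"
  shows "env_rel n i \<in> carrier (free_algebra (n + 1))"
proof -
  have pow: "(-1) ^ k \<in> carrier (free_algebra (n + 1))" for k
    using carrier_of_int[of "(-1) ^ k" "n + 1"] by simp
  have "set (omit n i gen) \<subseteq> carrier (free_algebra (n + 1))"
    by (auto simp: omit_def intro!: carrier_gen)
  then show ?thesis
    unfolding env_rel_def using assms by (intro carrier_mult carrier_diff pow carrier_alt carrier_gen) auto
qed

lemma ideal_env_ideal: "ideal (env_ideal n) (free_algebra (n + 1))"
  unfolding env_ideal_def
  by (rule ring.genideal_ideal[OF ring_free_algebra]) (blast intro: carrier_env_rel)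

lemma ring_univ_env: "ring (univ_env n)"
  unfolding univ_env_def by (rule ideal.quotient_is_ring[OF ideal_env_ideal])

context L_algebra
begin

abbreviation coordinate :: "'v \<Rightarrow> nat \<Rightarrow> 'f" where
  "coordinate v k \<equiv> representation (e ` {1..n+1}) v (e k)"

lemma natural_map_carrier_aux:
  "(\<Sum>k = 1..n+1. of_scalar (coordinate v k) * gen k) \<in> carrier (free_algebra (n + 1))"
  by (intro carrier_sum carrier_mult carrier_of_scalar carrier_gen)

lemma natural_map_in_univ_env: "natural_map scale n e v \<in> carrier (univ_env n)"
  unfolding natural_map_def univ_env_def FactRing_def A_RCOSETS_def'
  using natural_map_carrier_aux by auto

lemma natural_map_basis:
  assumes "i \<in> {1..n+1}"
  shows "natural_map scale n e (e i) = env_ideal n +>\<^bsub>free_algebra (n + 1)\<^esub> gen i"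
proof -
  have "of_scalar (coordinate (e i) k) * gen k = (if k = i then gen i else 0)" if "k \<in> {1..n+1}" for k
    using assms that basis_inj representation_basis[OF basis_independent, of "e i"]
    by (auto simp: of_scalar_1 inj_on_eq_iff of_scalar_def)
  then have "(\<Sum>k = 1..n+1. of_scalar (coordinate (e i) k) * gen k) =
      (\<Sum>k = 1..n+1. if k = i then gen i else 0)"
    by (rule sum.cong[OF refl])
  also have "\<dots> = gen i"
    using assms by (subst sum.delta) auto
  finally have "(\<Sum>k = 1..n+1. of_scalar (coordinate (e i) k) * gen k) = gen i" .
  then show ?thesis
    unfolding natural_map_def by simp
qed

lemma natural_map_add:
  "natural_map scale n e (v + w) = natural_map scale n e v \<oplus>\<^bsub>univ_env n\<^esub> natural_map scale n e w"
proof -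
  interpret I: ideal "env_ideal n" "free_algebra (n + 1)" by (rule ideal_env_ideal)
  have "coordinate (v + w) k = coordinate v k + coordinate w k" for k
    by (subst representation_add[OF basis_independent]) (simp_all only: basis_span UNIV_I)
  then have "(\<Sum>k = 1..n+1. of_scalar (coordinate (v + w) k) * gen k) =
      (\<Sum>k = 1..n+1. of_scalar (coordinate v k) * gen k) + (\<Sum>k = 1..n+1. of_scalar (coordinate w k) * gen k)"
    by (simp add: of_scalar_def single_add distrib_right sum.distrib)
  then show ?thesis
    unfolding natural_map_def univ_env_def FactRing_def
    using I.a_rcos_sum[OF natural_map_carrier_aux[of v] natural_map_carrier_aux[of w]] by simp
qed

lemma natural_map_scale:
  "natural_map scale n e (scale c v) =
     (env_ideal n +>\<^bsub>free_algebra (n + 1)\<^esub> of_scalar c) \<otimes>\<^bsub>univ_env n\<^esub> natural_map scale n e v"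
proof -
  interpret I: ideal "env_ideal n" "free_algebra (n + 1)" by (rule ideal_env_ideal)
  have "coordinate (scale c v) k = c * coordinate v k" for k
    by (subst representation_scale[OF basis_independent]) (simp_all only: basis_span UNIV_I)
  then have "(\<Sum>k = 1..n+1. of_scalar (coordinate (scale c v) k) * gen k) =
      of_scalar c * (\<Sum>k = 1..n+1. of_scalar (coordinate v k) * gen k)"
    by (simp add: of_scalar_def mult_single sum_distrib_left mult.assoc[symmetric] del: sum.cl_ivl_Suc)
  then show ?thesis
    unfolding natural_map_def univ_env_def FactRing_def
    using I.rcoset_mult_add[OF carrier_of_scalar natural_map_carrier_aux[of v]] by simp
qed

end

end

theory Submission
  imports Defs "Jordan_Normal_Form.Determinant"
begin

text \<open>
  The coefficients of a vector are recovered from its image by linear functionals on the free algebra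
  that vanish on the ideal $I$, so it suffices to find, for each $j$, such a functional with value
  $1$ at $x_j$ and $0$ at the other generators.

  Order words by length and then lexicographically. In $G_i$ the largest word is the decreasing
  product $m_i = x_{n+1}\cdots\widehat{x}_i\cdots x_1$: every other word is a rearrangement of it
  or the single letter $x_i$. Its coefficient is the sign of the reversal of $n$ letters
  times $(-1)^{\lfloor n/2\rfloor}$, which is $1$. Hence each $G_i$ is a rewriting rule that
  replaces $m_i$ by smaller words. By Bergman's diamond lemma, proved below in the
  locale \<open>word_rewriting\<close>, a functional that kills $I$ may be prescribed arbitrarily on the words
  that contain no $m_i$, among them the single letters, provided that every overlap of two words
  $m_i$, $m_j$ resolves.

  There is exactly one overlap, $x_{n+1}x_n\cdots x_1 = x_{n+1}\,m_{n+1} = m_1\,x_1$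
  (\<open>descending_overlap\<close>). Expanding the alternating sum of all $n+1$ generators along its first and
  along its last factor gives, for even $n$,
  $$\sum_{i=1}^{n+1} (-1)^i\,(x_i G_i - G_i x_i) = 0$$
  (\<open>env_rel_commutators\<close>), since the linear part of $G_i$ commutes with $x_i$. The two terms of
  this relation with largest word $x_{n+1}\cdots x_1$ are $x_{n+1}G_{n+1}$ and
  $G_1 x_1$, and all the other terms have smaller words, so the overlap resolves.
\<close>

section \<open>Linear functionals on the free algebra\<close>

abbreviation word_term :: "'f::field \<Rightarrow> 'a list \<Rightarrow> 'a word0 \<Rightarrow>\<^sub>0 'f" where
  "word_term c w \<equiv> Poly_Mapping.single (Word w) c"

definition lin_ext :: "('a list \<Rightarrow> 'f::field) \<Rightarrow> ('a word0 \<Rightarrow>\<^sub>0 'f) \<Rightarrow> 'f" where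
  "lin_ext \<phi> p = (\<Sum>w \<in> Poly_Mapping.keys p. Poly_Mapping.lookup p w * \<phi> (letters w))"

lemma lin_ext_superset:
  assumes "finite A" "Poly_Mapping.keys p \<subseteq> A"
  shows "lin_ext \<phi> p = (\<Sum>w \<in> A. Poly_Mapping.lookup p w * \<phi> (letters w))"
  unfolding lin_ext_def using assms
  by (intro sum.mono_neutral_left) (auto simp: in_keys_iff)

lemma lin_ext_0 [simp]: "lin_ext \<phi> 0 = 0"
  by (simp add: lin_ext_def)

lemma lin_ext_add: "lin_ext \<phi> (p + q) = lin_ext \<phi> p + lin_ext \<phi> q"
proof -
  let ?A = "Poly_Mapping.keys p \<union> Poly_Mapping.keys q"
  have "lin_ext \<phi> x = (\<Sum>w \<in> ?A. Poly_Mapping.lookup x w * \<phi> (letters w))" if "x \<in> {p, q, p + q}" for x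
    using that Poly_Mapping.keys_add[of p q] by (intro lin_ext_superset) auto
  then show ?thesis
    by (simp add: lookup_add distrib_right sum.distrib)
qed

lemma lin_ext_uminus: "lin_ext \<phi> (- p) = - lin_ext \<phi> p"
  using lin_ext_add[of \<phi> p "- p"] by (simp add: eq_neg_iff_add_eq_0 add.commute)

lemma lin_ext_diff: "lin_ext \<phi> (p - q) = lin_ext \<phi> p - lin_ext \<phi> q"
  using lin_ext_add[of \<phi> p "- q"] by (simp add: lin_ext_uminus)

lemma lin_ext_sum: "lin_ext \<phi> (sum f A) = (\<Sum>x \<in> A. lin_ext \<phi> (f x))"
  by (induction A rule: infinite_finite_induct) (simp_all add: lin_ext_add)

lemma lin_ext_word_term [simp]: "lin_ext \<phi> (word_term c w) = c * \<phi> w"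
  by (simp add: lin_ext_def)

lemma lin_ext_cong:
  assumes "\<And>w. w \<in> Poly_Mapping.keys p \<Longrightarrow> \<phi> (letters w) = \<psi> (letters w)"
  shows "lin_ext \<phi> p = lin_ext \<psi> p"
  using assms by (simp add: lin_ext_def)

lemma lin_ext_swap:
  "lin_ext (\<lambda>v. lin_ext (\<lambda>w. \<phi> v w) q) p = lin_ext (\<lambda>w. lin_ext (\<lambda>v. \<phi> v w) p) q"
  unfolding lin_ext_def sum_distrib_left
  by (subst sum.swap) (simp add: mult.left_commute)

lemma word_term_expansion:
  "p = (\<Sum>w \<in> Poly_Mapping.keys p. word_term (Poly_Mapping.lookup p w) (letters w))"
  by (rule poly_mapping_eqI) (simp add: lookup_sum lookup_single when_def in_keys_iff)

lemma lin_ext_mult: "lin_ext \<phi> (p * q) = lin_ext (\<lambda>v. lin_ext (\<lambda>w. \<phi> (v @ w)) q) p"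
proof -
  have "p * q = (\<Sum>v \<in> Poly_Mapping.keys p. \<Sum>w \<in> Poly_Mapping.keys q.
      word_term (Poly_Mapping.lookup p v * Poly_Mapping.lookup q w) (letters v @ letters w))"
    by (subst word_term_expansion[of p], subst word_term_expansion[of q])
      (simp add: sum_product mult_single plus_word0_def)
  then show ?thesis
    by (simp add: lin_ext_sum lin_ext_def[of _ p] lin_ext_def[of _ q] sum_distrib_left mult.assoc)
qed

section \<open>The diamond lemma\<close>

text \<open>
  Each \<open>rel i\<close> is read as the rule replacing the word \<open>lead i\<close> by \<open>lead i - rel i\<close>, a combination of
  \<open>r\<close>-smaller words. The usual condition on an overlap $W = m_i b = a m_j$ asks that
  $G_i b - a G_j$ be a combination of elements $u G_k v$ with $u m_k v$ smaller than $W$. The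
  condition \<open>overlap_resolves\<close> is its dual form: every functional that kills all these $u G_k v$ takes
  equal values on $G_i b$ and $a G_j$. That is the form in which the induction below uses it.
\<close>

locale word_rewriting =
  fixes I :: "'i set" and lead :: "'i \<Rightarrow> 'a list" and rel :: "'i \<Rightarrow> 'a word0 \<Rightarrow>\<^sub>0 'f::field"
    and r :: "('a list \<times> 'a list) set"
  assumes wf: "wf r"
    and compatible: "(u, v) \<in> r \<Longrightarrow> (a @ u @ b, a @ v @ b) \<in> r"
    and tail_smaller:
      "i \<in> I \<Longrightarrow> w \<in> Poly_Mapping.keys (word_term 1 (lead i) - rel i) \<Longrightarrow> (letters w, lead i) \<in> r"
    and no_inclusion:
      "i \<in> I \<Longrightarrow> j \<in> I \<Longrightarrow> lead j = a @ lead i @ b \<Longrightarrow> a = [] \<and> b = [] \<and> i = j"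
    and overlap_resolves:
      "i \<in> I \<Longrightarrow> j \<in> I \<Longrightarrow> lead i @ b = a @ lead j \<Longrightarrow> a \<noteq> [] \<Longrightarrow> length a < length (lead i) \<Longrightarrow>
       (\<And>u k v. k \<in> I \<Longrightarrow> (u @ lead k @ v, a @ lead j) \<in> r \<Longrightarrow>
          lin_ext (\<lambda>w. \<psi> (u @ w @ v)) (rel k) = 0) \<Longrightarrow>
       lin_ext (\<lambda>w. \<psi> (w @ b)) (rel i) = lin_ext (\<lambda>w. \<psi> (a @ w)) (rel j)"
begin

definition tail :: "'i \<Rightarrow> 'a word0 \<Rightarrow>\<^sub>0 'f" where
  "tail i = word_term 1 (lead i) - rel i"

definition reducible :: "'a list \<Rightarrow> bool" where
  "reducible w \<longleftrightarrow> (\<exists>a i b. i \<in> I \<and> w = a @ lead i @ b)"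

definition redex :: "'a list \<Rightarrow> 'a list \<times> 'i \<times> 'a list" where
  "redex w = (SOME (a, i, b). i \<in> I \<and> w = a @ lead i @ b)"

lemma redexD:
  assumes "reducible w" "redex w = (a, i, b)"
  shows "i \<in> I" "w = a @ lead i @ b"
proof -
  have "case redex w of (a, i, b) \<Rightarrow> i \<in> I \<and> w = a @ lead i @ b"
    unfolding redex_def by (rule someI_ex) (use assms(1) in \<open>auto simp: reducible_def\<close>)
  then show "i \<in> I" "w = a @ lead i @ b"
    using assms(2) by auto
qed

context
  fixes f :: "'a list \<Rightarrow> 'f"
begin

text \<open>
  The functional is defined on words by recursion along \<open>r\<close>: on irreducible words it is the prescribed
  \<open>f\<close>, and on other words one arbitrarily chosen occurrence of a leading word is rewritten.
  That the choice does not matter is the content of \<open>normal_form_rel\<close>.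
\<close>

function normal_form :: "'a list \<Rightarrow> 'f" where
  "normal_form w = (if reducible w then
      (case redex w of (a, i, b) \<Rightarrow> \<Sum>t \<in> Poly_Mapping.keys (tail i).
         Poly_Mapping.lookup (tail i) t * normal_form (a @ letters t @ b))
    else f w)"
  by pat_completeness auto
termination
proof (relation r, rule wf, clarify)
  fix w a i b t
  assume "reducible w" "(a, i, b) = redex w" "t \<in> Poly_Mapping.keys (tail i)"
  then show "(a @ letters t @ b, w) \<in> r"
    using redexD[of w a i b] compatible[OF tail_smaller[of i t]] by (simp add: tail_def)
qed

declare normal_form.simps [simp del]

lemma normal_form_irreducible: "\<not> reducible w \<Longrightarrow> normal_form w = f w"
  by (subst normal_form.simps) simp

lemma normal_form_redex:
  assumes "reducible w" "redex w = (a, i, b)"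
  shows "normal_form w = lin_ext (\<lambda>t. normal_form (a @ t @ b)) (tail i)"
  using assms by (subst normal_form.simps) (simp add: lin_ext_def)

lemma lin_ext_rel: "lin_ext \<psi> (rel i) = \<psi> (lead i) - lin_ext \<psi> (tail i)"
  by (simp add: tail_def lin_ext_diff)

text \<open>
  Two occurrences of leading words inside one word coincide, are disjoint, or overlap properly;
  \<open>no_inclusion\<close> rules out that one lies strictly inside the other.
\<close>

lemma occurrences_cases:
  assumes "i \<in> I" "j \<in> I" "a @ lead i @ b = a' @ lead j @ b'" "length a \<le> length a'"
  obtains (same) "a = a'" "i = j" "b = b'"
    | (disjoint) y where "a' = a @ lead i @ y" "b = y @ lead j @ b'"
    | (overlap) x y where "a' = a @ x" "b = y @ b'" "lead i @ y = x @ lead j"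
        "x \<noteq> []" "length x < length (lead i)"
proof -
  obtain x where x: "a' = a @ x" "lead i @ b = x @ lead j @ b'"
  proof -
    from assms(3) consider us where "a = a' @ us" "us @ lead i @ b = lead j @ b'"
      | us where "a @ us = a'" "lead i @ b = us @ lead j @ b'"
      unfolding append_eq_append_conv2[of a] by blast
    then show ?thesis
      using assms(4) that[of "[]"] that by cases auto
  qed
  consider z where "lead i = x @ z" "z @ b = lead j @ b'" | z where "x = lead i @ z" "b = z @ lead j @ b'"
    using x(2) by (auto simp: append_eq_append_conv2)
  then show thesis
  proof cases
    case 2
    then show ?thesis using x disjoint by simp
  next
    case (1 z)
    show ?thesis
    proof (cases "z = []")
      case True
      then show ?thesis using 1 x disjoint[of "[]"] by simp
    next
      case nonempty: False
      consider q where "z = lead j @ q" "b' = q @ b" | q where "lead j = z @ q" "b = q @ b'"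
        using 1(2) unfolding append_eq_append_conv2[of z] by metis
      then show ?thesis
      proof cases
        case (1 q)
        then have "x = [] \<and> q = [] \<and> j = i"
          using no_inclusion[OF assms(2,1)] \<open>lead i = x @ z\<close> by blast
        then show ?thesis
          using x(1) 1(2) same by auto
      next
        case (2 q)
        show ?thesis
        proof (cases "x = []")
          case True
          then have "q = [] \<and> i = j"
            using no_inclusion[OF assms(1,2), of "[]" q] 1(1) 2(1) by simp
          then show ?thesis
            using True x(1) 2(2) same by auto
        next
          case False
          then show ?thesis
            using overlap[OF x(1) 2(2)] 1(1) 2(1) nonempty by simp
        qed
      qed
    qed
  qed
qed

text \<open>
  Induction on the word $W = u m_k v$. The claim says that rewriting the given occurrence of $m_k$
  does not change the value, whereas the definition rewrites the chosen one; so any two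
  occurrences must lead to the same value \<open>reduct\<close>. After one rewriting step all words are smaller than
  $W$, and there the induction hypothesis applies: for disjoint occurrences it allows rewriting the second
  occurrence as well, and both orders give the same double sum; for overlapping
  ones it supplies the premise of \<open>overlap_resolves\<close>.
\<close>

lemma normal_form_rel:
  assumes "k \<in> I"
  shows "lin_ext (\<lambda>w. normal_form (u @ w @ v)) (rel k) = 0"
  using assms
proof (induction "u @ lead k @ v" arbitrary: u k v rule: wf_induct_rule[OF wf])
  case (1 u k v)
  define W where "W = u @ lead k @ v"
  define reduct where "reduct a i b = lin_ext (\<lambda>t. normal_form (a @ t @ b)) (tail i)" for a i b
  have IH: "lin_ext (\<lambda>w. normal_form (a @ w @ b)) (rel i) = 0" if "(a @ lead i @ b, W) \<in> r" "i \<in> I" for a i b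
    using 1(1)[OF that(1)[unfolded W_def]] that(2) by simp
  have reduce: "normal_form (a @ lead i @ b) = reduct a i b" if "(a @ lead i @ b, W) \<in> r" "i \<in> I" for a i b
    using IH[OF that] by (simp add: lin_ext_rel reduct_def)
  have smaller: "(a @ letters t @ b, W) \<in> r" if "i \<in> I" "a @ lead i @ b = W" "t \<in> Poly_Mapping.keys (tail i)" for a i b t
    using compatible[OF tail_smaller[of i t]] that by (auto simp: tail_def)
  have ordered: "reduct a i b = reduct a' j b'"
    if i: "i \<in> I" and j: "j \<in> I" and W1: "a @ lead i @ b = W" and W2: "a' @ lead j @ b' = W"
      and len: "length a \<le> length a'" for a i b a' j b'
  proof (rule occurrences_cases[OF i j trans[OF W1 W2[symmetric]] len])
    fix y assume y: "a' = a @ lead i @ y" "b = y @ lead j @ b'"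
    have "reduct a i b = lin_ext (\<lambda>s. lin_ext (\<lambda>t. normal_form (a @ s @ y @ t @ b')) (tail j)) (tail i)"
      unfolding reduct_def
    proof (rule lin_ext_cong)
      fix s assume "s \<in> Poly_Mapping.keys (tail i)"
      then have "((a @ letters s @ y) @ lead j @ b', W) \<in> r"
        using smaller[OF i W1] y by simp
      from reduce[OF this j]
      show "normal_form (a @ letters s @ b) = lin_ext (\<lambda>t. normal_form (a @ letters s @ y @ t @ b')) (tail j)"
        by (simp add: reduct_def y)
    qed
    also have "\<dots> = lin_ext (\<lambda>t. lin_ext (\<lambda>s. normal_form (a @ s @ y @ t @ b')) (tail i)) (tail j)"
      by (rule lin_ext_swap)
    also have "\<dots> = reduct a' j b'"
      unfolding reduct_def
    proof (rule lin_ext_cong)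
      fix t assume "t \<in> Poly_Mapping.keys (tail j)"
      then have "(a @ lead i @ (y @ letters t @ b'), W) \<in> r"
        using smaller[OF j W2] y by simp
      from reduce[OF this i]
      show "lin_ext (\<lambda>s. normal_form (a @ s @ y @ letters t @ b')) (tail i) = normal_form (a' @ letters t @ b')"
        by (simp add: reduct_def y)
    qed
    finally show ?thesis .
  next
    fix x y assume xy: "a' = a @ x" "b = y @ b'" "lead i @ y = x @ lead j" "x \<noteq> []" "length x < length (lead i)"
    have "lin_ext (\<lambda>w. normal_form (a @ (w @ y) @ b')) (rel i) = lin_ext (\<lambda>w. normal_form (a @ (x @ w) @ b')) (rel j)"
    proof (rule overlap_resolves[OF i j xy(3-5)])
      fix u k v assume k: "k \<in> I" and less: "(u @ lead k @ v, x @ lead j) \<in> r"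
      have "((a @ u) @ lead k @ (v @ b'), W) \<in> r"
        using compatible[OF less, of a b'] W2 xy by simp
      from IH[OF this k] show "lin_ext (\<lambda>w. normal_form (a @ (u @ w @ v) @ b')) (rel k) = 0"
        by simp
    qed
    moreover have "lin_ext (\<lambda>w. normal_form (a @ w @ b)) (rel i) = normal_form W - reduct a i b"
      "lin_ext (\<lambda>w. normal_form (a' @ w @ b')) (rel j) = normal_form W - reduct a' j b'"
      by (simp_all add: lin_ext_rel reduct_def W1 W2)
    ultimately show ?thesis
      by (simp add: xy)
  qed simp
  have red: "reducible W"
    using 1(2) by (auto simp: reducible_def W_def)
  obtain a i b where redex: "redex W = (a, i, b)"
    by (cases "redex W")
  note D = redexD[OF red redex]
  have "normal_form W = reduct a i b"
    using normal_form_redex[OF red redex] by (simp add: reduct_def)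
  also have "\<dots> = reduct u k v"
    using ordered[OF D(1) 1(2) D(2)[symmetric] W_def[symmetric]]
      ordered[OF 1(2) D(1) W_def[symmetric] D(2)[symmetric]] by (metis nat_le_linear)
  finally show ?case
    by (simp add: lin_ext_rel reduct_def W_def)
qed

end

text \<open>
  This is Bergman's diamond lemma in dual form: as the functional is arbitrary on irreducible words, these
  are linearly independent modulo the two-sided ideal generated by the relations.
\<close>

theorem diamond:
  obtains \<phi> where "\<And>w. \<not> reducible w \<Longrightarrow> \<phi> w = f w"
    and "\<And>k u v. k \<in> I \<Longrightarrow> lin_ext (\<lambda>w. \<phi> (u @ w @ v)) (rel k) = 0"
  using that[of "normal_form f"] normal_form_irreducible normal_form_rel by simp

end

section \<open>Alternating sums\<close>

text \<open>
  The permutations of $n+1$ points are sorted by their value \<open>k\<close> at the point \<open>i\<close>. This is the combinatorial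
  part of the Laplace expansion, used for the first and for the last position.
\<close>

lemma sum_permutations_insert:
  assumes "i \<le> n"
  shows "(\<Sum>\<sigma> | \<sigma> permutes {..<Suc n}. h \<sigma>) =
    (\<Sum>k\<le>n. \<Sum>q | q permutes {..<n}. h (permutation_insert i k q))"
proof -
  have "(\<Sum>\<sigma> | \<sigma> permutes {..<Suc n}. h \<sigma>) =
      (\<Sum>k\<le>n. \<Sum>\<sigma> \<in> {\<sigma> \<in> {\<sigma>. \<sigma> permutes {..<Suc n}}. \<sigma> i = k}. h \<sigma>)"
  proof (rule sum.group[symmetric])
    show "(\<lambda>\<sigma>. \<sigma> i) ` {\<sigma>. \<sigma> permutes {..<Suc n}} \<subseteq> {..n}"
    proof (rule image_subsetI)
      fix \<sigma> assume "\<sigma> \<in> {\<sigma>. \<sigma> permutes {..<Suc n}}"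
      then show "\<sigma> i \<in> {..n}"
        using permutes_in_image[of \<sigma> "{..<Suc n}" i] assms by (simp add: less_Suc_eq_le)
    qed
  qed (simp_all add: finite_permutations)
  also have "\<dots> = (\<Sum>k\<le>n. \<Sum>q | q permutes {..<n}. h (permutation_insert i k q))"
  proof (rule sum.cong[OF refl])
    fix k assume "k \<in> {..n}"
    then have "{\<sigma> \<in> {\<sigma>. \<sigma> permutes {..<Suc n}}. \<sigma> i = k} = permutation_insert i k ` {q. q permutes {..<n}}"
      and "inj_on (permutation_insert i k) {q. q permutes {..<n}}"
      using permutation_fix[of i n k] permutation_insert_inj_on[of i n k] assms
      by (simp_all add: lessThan_atLeast0)
    then show "(\<Sum>\<sigma> \<in> {\<sigma> \<in> {\<sigma>. \<sigma> permutes {..<Suc n}}. \<sigma> i = k}. h \<sigma>) =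
        (\<Sum>q | q permutes {..<n}. h (permutation_insert i k q))"
      by (simp add: sum.reindex)
  qed
  finally show ?thesis .
qed

lemma permute_list_permutation_insert_first:
  assumes "q permutes {..<n}" "k \<le> n"
  shows "permute_list (permutation_insert 0 k q) (map z [0..<Suc n]) = z k # permute_list q (map (z \<circ> insert_index k) [0..<n])"
proof (rule nth_equalityI)
  have "q j < n" if "j < n" for j
    using permutes_in_image[OF assms(1), of j] that by simp
  moreover have "map z [0..<Suc n] ! j = z j" if "j \<le> n" for j
    using that by (simp del: upt_Suc)
  moreover fix i assume "i < length (permute_list (permutation_insert 0 k q) (map z [0..<Suc n]))"
  ultimately show "permute_list (permutation_insert 0 k q) (map z [0..<Suc n]) ! i = (z k # permute_list q (map (z \<circ> insert_index k) [0..<n])) ! i"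
    using assms(2)
    by (cases i) (auto simp: permute_list_def permutation_insert_expand insert_index_def nth_append less_Suc_eq_le Suc_le_eq
        simp del: upt_Suc)
qed simp

lemma permute_list_permutation_insert_last:
  assumes "q permutes {..<n}" "k \<le> n"
  shows "permute_list (permutation_insert n k q) (map z [0..<Suc n]) = permute_list q (map (z \<circ> insert_index k) [0..<n]) @ [z k]"
proof (rule nth_equalityI)
  have "q j < n" if "j < n" for j
    using permutes_in_image[OF assms(1), of j] that by simp
  moreover have "map z [0..<Suc n] ! j = z j" if "j \<le> n" for j
    using that by (simp del: upt_Suc)
  moreover fix i assume "i < length (permute_list (permutation_insert n k q) (map z [0..<Suc n]))"
  ultimately show "permute_list (permutation_insert n k q) (map z [0..<Suc n]) ! i = (permute_list q (map (z \<circ> insert_index k) [0..<n]) @ [z k]) ! i"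
    using assms(2)
    by (cases i) (auto simp: permute_list_def permutation_insert_expand insert_index_def nth_append less_Suc_eq_le Suc_le_eq
        simp del: upt_Suc)
qed simp

lemma alt_expand_first:
  fixes z :: "nat \<Rightarrow> 'a::ring_1"
  shows "alt (map z [0..<Suc n]) = (\<Sum>k\<le>n. (-1) ^ k * (z k * alt (map (z \<circ> insert_index k) [0..<n])))"
proof -
  have "alt (map z [0..<Suc n]) = (\<Sum>k\<le>n. \<Sum>q | q permutes {..<n}.
      of_int (sign (permutation_insert 0 k q)) *
      prod_list (permute_list (permutation_insert 0 k q) (map z [0..<Suc n])))"
    unfolding alt_def length_map length_upt diff_zero by (rule sum_permutations_insert) simp
  also have "\<dots> = (\<Sum>k\<le>n. (-1) ^ k * (z k * alt (map (z \<circ> insert_index k) [0..<n])))"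
  proof (rule sum.cong[OF refl])
    fix k assume k: "k \<in> {..n}"
    have "of_int (sign (permutation_insert 0 k q)) *
          prod_list (permute_list (permutation_insert 0 k q) (map z [0..<Suc n])) =
        (-1) ^ k * (z k * (of_int (sign q) * prod_list (permute_list q (map (z \<circ> insert_index k) [0..<n]))))"
      if q: "q permutes {..<n}" for q
    proof -
      have "of_int (sign (permutation_insert 0 k q)) = (-1 :: 'a) ^ k * of_int (sign q)"
        using signof_permutation_insert[of q n 0 k] q k by (simp add: lessThan_atLeast0)
      then show ?thesis
        using permute_list_permutation_insert_first[OF q, of k z] k
        by (simp add: mult.assoc mult_of_int_commute del: upt_Suc)
    qed
    then show "(\<Sum>q | q permutes {..<n}. of_int (sign (permutation_insert 0 k q)) *
          prod_list (permute_list (permutation_insert 0 k q) (map z [0..<Suc n]))) =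
        (-1) ^ k * (z k * alt (map (z \<circ> insert_index k) [0..<n]))"
      by (simp add: alt_def sum_distrib_left)
  qed
  finally show ?thesis .
qed

lemma alt_expand_last:
  fixes z :: "nat \<Rightarrow> 'a::ring_1"
  shows "alt (map z [0..<Suc n]) = (\<Sum>k\<le>n. (-1) ^ (n + k) * (alt (map (z \<circ> insert_index k) [0..<n]) * z k))"
proof -
  have "alt (map z [0..<Suc n]) = (\<Sum>k\<le>n. \<Sum>q | q permutes {..<n}.
      of_int (sign (permutation_insert n k q)) *
      prod_list (permute_list (permutation_insert n k q) (map z [0..<Suc n])))"
    unfolding alt_def length_map length_upt diff_zero by (rule sum_permutations_insert) simp
  also have "\<dots> = (\<Sum>k\<le>n. (-1) ^ (n + k) * (alt (map (z \<circ> insert_index k) [0..<n]) * z k))"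
  proof (rule sum.cong[OF refl])
    fix k assume k: "k \<in> {..n}"
    have "of_int (sign (permutation_insert n k q)) *
          prod_list (permute_list (permutation_insert n k q) (map z [0..<Suc n])) =
        (-1) ^ (n + k) * (of_int (sign q) * prod_list (permute_list q (map (z \<circ> insert_index k) [0..<n])) * z k)"
      if q: "q permutes {..<n}" for q
    proof -
      have "of_int (sign (permutation_insert n k q)) = (-1 :: 'a) ^ (n + k) * of_int (sign q)"
        using signof_permutation_insert[of q n n k] q k by (simp add: lessThan_atLeast0)
      then show ?thesis
        using permute_list_permutation_insert_last[OF q, of k z] k
        by (simp add: mult.assoc del: upt_Suc)
    qed
    then show "(\<Sum>q | q permutes {..<n}. of_int (sign (permutation_insert n k q)) *
          prod_list (permute_list (permutation_insert n k q) (map z [0..<Suc n]))) =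
        (-1) ^ (n + k) * (alt (map (z \<circ> insert_index k) [0..<n]) * z k)"
      by (simp add: alt_def sum_distrib_left sum_distrib_right)
  qed
  finally show ?thesis .
qed

text \<open>
  The two expansions have the signs $(-1)^k$ and $(-1)^{n+k}$, which agree because $n$ is even;
  subtracting them leaves commutators.
\<close>

lemma alternating_commutators_vanish:
  fixes z :: "nat \<Rightarrow> 'a::ring_1"
  assumes "even n"
  shows "(\<Sum>k\<le>n. (-1) ^ k * (z k * alt (map (z \<circ> insert_index k) [0..<n])
      - alt (map (z \<circ> insert_index k) [0..<n]) * z k)) = 0"
  using alt_expand_first[of z n] alt_expand_last[of z n] assms
  by (simp add: right_diff_distrib sum_subtractf power_add)

text \<open>
  The permutation that turns the increasing word of an alternating sum into the decreasing one. Its sign is the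
  normalising factor in \<open>env_rel\<close>, and so makes the leading coefficient equal to $1$.
\<close>

definition reversal :: "nat \<Rightarrow> nat \<Rightarrow> nat" where
  "reversal n i = (if i < n then n - 1 - i else i)"

lemma reversal_permutes: "reversal n permutes {..<n}"
  by (rule bij_imp_permutes, rule bij_betw_byWitness[where f' = "reversal n"]) (auto simp: reversal_def)

lemma permute_list_reversal: "length xs = n \<Longrightarrow> permute_list (reversal n) xs = rev xs"
  by (rule nth_equalityI) (auto simp: permute_list_def reversal_def rev_nth)

lemma sign_reversal: "sign (reversal n) = (-1) ^ (n div 2)"
proof (induction n)
  case 0
  have "reversal 0 = id"
    by (auto simp: reversal_def)
  then show ?case by simp
next
  case (Suc n)
  have "reversal (Suc n) = permutation_insert 0 n (reversal n)"
    by (auto simp: fun_eq_iff reversal_def permutation_insert_expand)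
  then have "sign (reversal (Suc n)) = (-1) ^ n * sign (reversal n)"
    using signof_permutation_insert[of "reversal n" n 0 n, where 'a = int] reversal_permutes[of n]
    by (simp add: lessThan_atLeast0)
  then show ?case
    using Suc by (cases "even n") simp_all
qed

section \<open>The relations of the enveloping algebra\<close>

lemma omit_Suc:
  assumes "k \<le> n"
  shows "omit n (Suc k) z = map (z \<circ> Suc \<circ> insert_index k) [0..<n]"
proof -
  have "filter (\<lambda>j. j \<noteq> Suc k) [1..<n + 2] = [1..<Suc k] @ [Suc (Suc k)..<n + 2]"
  proof -
    have "[1..<n + 2] = [1..<Suc k] @ Suc k # [Suc (Suc k)..<n + 2]"
      using assms upt_add_eq_append[of 1 "Suc k" "n + 1 - k"] upt_conv_Cons[of "Suc k" "n + 2"] by simp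
    then show ?thesis
      by (auto simp: filter_id_conv simp del: upt_Suc)
  qed
  also have "\<dots> = map (Suc \<circ> insert_index k) [0..<n]"
    using assms by (intro nth_equalityI) (auto simp: nth_append insert_index_def)
  finally show ?thesis
    by (simp add: omit_def comp_assoc)
qed

lemma length_omit:
  assumes "i \<in> {1..n + 1}"
  shows "length (omit n i z) = n"
  using assms by (cases i) (simp_all add: omit_Suc)

text \<open>
  The linear term of each relation is a multiple of \<open>gen i\<close> and drops out of the commutator with
  \<open>gen i\<close>; what is left is the identity for alternating sums.
\<close>

lemma env_rel_commutators:
  assumes "even n"
  shows "(\<Sum>i = 1..n + 1. (-1) ^ i * (gen i * env_rel n i - env_rel n i * gen i)) = (0 :: 'f::field free_alg)"
proof -
  define a :: "nat \<Rightarrow> 'f free_alg" where "a i = alt (omit n i gen)" for i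
  have commutator: "gen i * env_rel n i - env_rel n i * gen i = (-1) ^ (n div 2) * (gen i * a i - a i * gen i)"
    for i
    unfolding env_rel_def a_def[symmetric]
    by (cases "even (n div 2)"; cases "even (n + i + 1)") (simp_all add: algebra_simps)
  have swap: "(-1) ^ Suc k * ((-1) ^ l * p) = (-1) ^ Suc l * ((-1) ^ k * p)" for k l and p :: "'f free_alg"
    by (cases "even k"; cases "even l") simp_all
  have "(\<Sum>i = 1..n + 1. (-1) ^ i * (gen i * env_rel n i - env_rel n i * gen i)) =
      (\<Sum>k\<le>n. (-1) ^ Suc k * (gen (Suc k) * env_rel n (Suc k) - env_rel n (Suc k) * gen (Suc k)))"
    by (simp add: sum.atLeast_Suc_atMost_Suc_shift atMost_atLeast0 comp_def del: sum.cl_ivl_Suc)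
  also have "\<dots> = (\<Sum>k\<le>n. (-1) ^ Suc (n div 2) * ((-1) ^ k * (gen (Suc k) * a (Suc k) - a (Suc k) * gen (Suc k))))"
    unfolding commutator by (rule sum.cong[OF refl swap])
  also have "\<dots> = (-1) ^ Suc (n div 2) * (\<Sum>k\<le>n. (-1) ^ k * (gen (Suc k) * a (Suc k) - a (Suc k) * gen (Suc k)))"
    by (rule sum_distrib_left[symmetric])
  also have "(\<Sum>k\<le>n. (-1) ^ k * (gen (Suc k) * a (Suc k) - a (Suc k) * gen (Suc k))) = 0"
    using alternating_commutators_vanish[OF assms, of "gen \<circ> Suc"]
    by (simp add: a_def omit_Suc)
  finally show ?thesis by simp
qed

lemma prod_list_gen: "prod_list (map gen w) = word_term 1 w"
  by (induction w) (simp_all add: gen_def mult_single plus_word0_def flip: single_one zero_word0_def)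

lemma alt_gen: "alt (map gen w) = (\<Sum>\<sigma> | \<sigma> permutes {..<length w}. of_int (sign \<sigma>) * word_term 1 (permute_list \<sigma> w))"
  by (simp add: alt_def permute_list_map prod_list_gen)

definition descending :: "nat \<Rightarrow> nat \<Rightarrow> nat list" where
  "descending n i = rev (omit n i id)"

lemma descending_props:
  assumes "i \<in> {1..n + 1}"
  shows "length (descending n i) = n" "set (descending n i) = {1..n + 1} - {i}"
    "sorted_wrt (>) (descending n i)" "distinct (descending n i)"
proof -
  show "length (descending n i) = n"
    using length_omit[OF assms] by (simp add: descending_def)
  show "set (descending n i) = {1..n + 1} - {i}" "distinct (descending n i)"
    by (auto simp: descending_def omit_def)
  show "sorted_wrt (>) (descending n i)"
    by (simp add: descending_def omit_def sorted_wrt_rev sorted_wrt_filter del: upt_Suc)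
qed

lemma permute_list_inj:
  assumes "distinct xs" "\<sigma> permutes {..<length xs}" "\<tau> permutes {..<length xs}"
    and "permute_list \<sigma> xs = permute_list \<tau> xs"
  shows "\<sigma> = \<tau>"
proof
  fix j
  show "\<sigma> j = \<tau> j"
  proof (cases "j < length xs")
    case True
    then have "xs ! \<sigma> j = xs ! \<tau> j"
      using assms(4) permute_list_nth[OF assms(2)] permute_list_nth[OF assms(3)] by metis
    then show ?thesis
      using True assms(1-3) permutes_in_image[of \<sigma> "{..<length xs}" j]
        permutes_in_image[of \<tau> "{..<length xs}" j]
      by (simp add: nth_eq_iff_index_eq)
  next
    case False
    then show ?thesis
      using assms(2,3) by (simp add: permutes_def)
  qed
qed

text \<open>
  As the letters are distinct, only the reversal produces the word \<open>descending n i\<close>, with coefficient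
  $1$; so this word cancels and only its other rearrangements and the letter \<open>i\<close> are left.
\<close>

lemma keys_env_rel_tail:
  assumes i: "i \<in> {1..n + 1}"
    and w: "w \<in> Poly_Mapping.keys (word_term 1 (descending n i) - env_rel n i :: 'f::field free_alg)"
  shows "letters w = [i] \<or> mset (letters w) = mset (descending n i) \<and> letters w \<noteq> descending n i"
proof -
  define xs where "xs = omit n i id"
  have len: "length xs = n"
    using length_omit[OF i] by (simp add: xs_def)
  have dist: "distinct xs"
    using descending_props(4)[OF i] by (simp add: descending_def xs_def)
  have rev: "descending n i = permute_list (reversal n) xs"
    by (simp add: descending_def xs_def[symmetric] permute_list_reversal len)
  have gens: "omit n i gen = map gen xs"
    by (simp add: xs_def omit_def)
  let ?S = "{\<sigma>. \<sigma> permutes {..<n}}"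
  let ?t = "\<lambda>\<sigma>. of_int (sign \<sigma>) * word_term 1 (permute_list \<sigma> xs) :: 'f free_alg"
  let ?e = "(-1) ^ (n div 2) :: 'f free_alg"
  have sgn: "?e * (?e * p) = p" for p
    by (cases "even (n div 2)") simp_all
  have "alt (omit n i gen) = ?t (reversal n) + sum ?t (?S - {reversal n})"
    unfolding gens alt_gen len
    by (rule sum.remove) (simp_all add: finite_permutations reversal_permutes)
  also have "?t (reversal n) = ?e * word_term 1 (descending n i)"
    by (simp add: sign_reversal rev)
  finally have eq: "word_term 1 (descending n i) - env_rel n i =
      ?e * ((-1) ^ (n + i + 1) * gen i - sum ?t (?S - {reversal n}))"
    unfolding env_rel_def by (simp add: distrib_left right_diff_distrib sgn)
  have unit: "Poly_Mapping.keys ((-1) ^ k * p) = Poly_Mapping.keys p" for k and p :: "'f free_alg"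
    by (cases "even k") simp_all
  have unit': "Poly_Mapping.keys (of_int (sign \<sigma>) * p) = Poly_Mapping.keys p" for \<sigma> :: "nat \<Rightarrow> nat" and p :: "'f free_alg"
    by (cases \<sigma> rule: sign_cases) simp_all
  have "w \<in> Poly_Mapping.keys (gen i :: 'f free_alg) \<union> (\<Union>\<sigma> \<in> ?S - {reversal n}. Poly_Mapping.keys (?t \<sigma>))"
    using w unfolding eq unit
    using keys_diff[of "(-1) ^ (n + i + 1) * gen i" "sum ?t (?S - {reversal n})"] unit[of "n + i + 1" "gen i"]
      Poly_Mapping.keys_sum[of ?t "?S - {reversal n}"] by blast
  then consider "w = Word [i]" | \<sigma> where "\<sigma> permutes {..<n}" "\<sigma> \<noteq> reversal n" "w = Word (permute_list \<sigma> xs)"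
    unfolding unit' by (auto simp: gen_def)
  then show ?thesis
  proof cases
    case 2
    then show ?thesis
      using permute_list_inj[OF dist, of \<sigma> "reversal n"] reversal_permutes[of n]
      by (auto simp: rev len)
  qed simp
qed

section \<open>Leading words\<close>

text \<open>
  At the first position where a rearrangement deviates from a decreasing word, it has a smaller letter,
  because the decreasing word always takes the largest letter that is left.
\<close>

lemma lenlex_below_descending:
  assumes "sorted_wrt (>) xs" "mset ys = mset xs" "ys \<noteq> xs"
  shows "(ys, xs :: nat list) \<in> lenlex less_than"
  using assms
proof (induction xs arbitrary: ys)
  case (Cons x xs)
  obtain y zs where ys: "ys = y # zs"
    using Cons.prems(2) by (cases ys) auto
  have len: "length zs = length xs"
    using mset_eq_length[OF Cons.prems(2)] ys by simp
  have "y \<in> set (x # xs)"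
    using mset_eq_setD[OF Cons.prems(2)] ys by auto
  then consider "y = x" | "y < x"
    using Cons.prems(1) by auto
  then show ?case
  proof cases
    case 1
    then show ?thesis
      using Cons ys by (simp add: Cons_lenlex_iff)
  next
    case 2
    then show ?thesis
      using len ys by (simp add: Cons_lenlex_iff)
  qed
qed simp

lemma descending_extend:
  "descending n 1 @ [1] = rev [1..<n + 2]" "(n + 1) # descending n (n + 1) = rev [1..<n + 2]"
proof -
  have "filter (\<lambda>j. j \<noteq> 1) [1..<n + 2] = [2..<n + 2]"
    by (simp add: upt_conv_Cons filter_id_conv del: upt_Suc) (simp add: numeral_2_eq_2)
  then show "descending n 1 @ [1] = rev [1..<n + 2]"
    by (simp add: descending_def omit_def upt_conv_Cons numeral_2_eq_2 del: upt_Suc)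
  show "(n + 1) # descending n (n + 1) = rev [1..<n + 2]"
    by (simp add: descending_def omit_def)
qed

text \<open>
  Let \<open>h\<close> be the first letter of the second word. It is the largest letter there, so $h \ge n$,
  since only one letter is missing. The letters of \<open>a\<close> precede \<open>h\<close> in the first, decreasing
  word, so they are distinct and larger than \<open>h\<close>; this leaves only \<open>a = [n + 1]\<close> and $h = n$.
\<close>

lemma descending_overlap:
  assumes i: "i \<in> {1..n + 1}" and j: "j \<in> {1..n + 1}"
    and eq: "descending n i @ b = a @ descending n j"
    and a: "a \<noteq> []" "length a < n"
  shows "i = 1" "j = n + 1" "a = [n + 1]" "b = [1]"
proof -
  note pi = descending_props[OF i] and pj = descending_props[OF j]
  obtain z where z: "descending n i = a @ z" "z @ b = descending n j"
    using eq a(2) pi(1) unfolding append_eq_append_conv2 by auto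
  have "z \<noteq> []"
    using z(1) pi(1) a(2) by auto
  then obtain h y where h: "z = h # y"
    by (cases z) auto
  have above: "x > h" if "x \<in> set a" for x
    using pi(3) that unfolding z(1) h by (auto simp: sorted_wrt_append)
  have h_max: "x \<le> h" if "x \<in> set (descending n j)" for x
    using that pj(3) unfolding z(2)[symmetric] h by (auto intro: less_imp_le)
  have h_ge: "h \<ge> n"
    using h_max[of n] h_max[of "n + 1"] a pj(2) by (cases "j = n + 1") auto
  have a_sub: "x = n + 1 \<and> h = n" if "x \<in> set a" for x
  proof -
    have "x \<in> set (descending n i)"
      using that z(1) by simp
    then have "x \<le> n + 1"
      using pi(2) by simp
    then show ?thesis
      using above[OF that] h_ge by simp
  qed
  obtain x a' where xa: "a = x # a'"
    using a(1) by (cases a) auto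
  have "distinct a"
    using pi(4) z(1) by simp
  then have "a' = []"
    using a_sub xa by (cases a') auto
  then show a_eq: "a = [n + 1]"
    using a_sub xa by simp
  have "h = n"
    using a_sub[of x] xa by simp
  then have "n + 1 \<notin> set (descending n j)"
    using h_max[of "n + 1"] by auto
  then show j_eq: "j = n + 1"
    using pj(2) by auto
  have "length b = 1"
    using arg_cong[OF eq, of length] pi(1) pj(1) a_eq by simp
  then obtain y where b: "b = [y]"
    by (cases b) auto
  have "descending n i @ [y] = descending n 1 @ [1]"
    using eq descending_extend[of n] b a_eq j_eq by simp
  then have same: "descending n i = descending n 1" and "y = 1"
    by simp_all
  then show "b = [1]"
    using b by simp
  show "i = 1"
  proof (rule ccontr)
    assume "i \<noteq> 1"
    then have "i \<in> set (descending n i)"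
      unfolding same using descending_props(2)[of 1 n] i by simp
    then show False
      by (simp add: pi(2))
  qed
qed


section \<open>Independence of the generators modulo the relations\<close>

lemma lin_ext_sign: "lin_ext \<phi> ((-1) ^ k * p) = (-1) ^ k * lin_ext \<phi> p"
  by (cases "even k") (simp_all add: lin_ext_uminus)

text \<open>
  In the sum of the commutators, \<open>L k\<close> and \<open>R k\<close> are the values of the functional on $x_k G_k$ and
  $G_k x_k$. Their largest words $x_k m_k$ and $m_k x_k$ are rearrangements of $x_{n+1}\cdots x_1$,
  and smaller than it except for $x_{n+1} m_{n+1}$ and $m_1 x_1$. So all the other values vanish,
  and the identity becomes $L_{n+1} = R_1$, the resolution of the only overlap.
\<close>

lemma word_rewriting_env_rel:
  assumes "even n" "n \<ge> 2"
  shows "word_rewriting {1..n + 1} (descending n) (env_rel n :: nat \<Rightarrow> 'f::field free_alg) (lenlex less_than)"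
proof
  show "wf (lenlex less_than)"
    by (intro wf_lenlex wf_less_than)
next
  fix u v a b :: "nat list"
  assume "(u, v) \<in> lenlex less_than"
  then show "(a @ u @ b, a @ v @ b) \<in> lenlex less_than"
    by (simp add: lenlex_append1 irrefl_def)
next
  fix i w
  assume i: "i \<in> {1..n + 1}"
    and w: "w \<in> Poly_Mapping.keys (word_term 1 (descending n i) - env_rel n i :: 'f free_alg)"
  from keys_env_rel_tail[OF i w] show "(letters w, descending n i) \<in> lenlex less_than"
  proof
    assume "letters w = [i]"
    then show ?thesis
      using descending_props(1)[OF i] assms(2) by (simp add: lenlex_conv)
  qed (simp add: lenlex_below_descending descending_props(3)[OF i])
next
  fix i j a b
  assume i: "i \<in> {1..n + 1}" and j: "j \<in> {1..n + 1}" and eq: "descending n j = a @ descending n i @ b"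
  have "length a + length b = 0"
    using arg_cong[OF eq, of length] descending_props(1)[OF i] descending_props(1)[OF j] by simp
  then have ab: "a = []" "b = []"
    by simp_all
  then have "{1..n + 1} - {j} = {1..n + 1} - {i}"
    using eq descending_props(2)[OF i] descending_props(2)[OF j] by simp
  then show "a = [] \<and> b = [] \<and> i = j"
    using ab i j by blast
next
  fix i j a b and \<psi> :: "nat list \<Rightarrow> 'f"
  assume i: "i \<in> {1..n + 1}" and j: "j \<in> {1..n + 1}"
    and eq: "descending n i @ b = a @ descending n j"
    and a: "a \<noteq> []" "length a < length (descending n i)"
    and kill: "\<And>u k v. k \<in> {1..n + 1} \<Longrightarrow> (u @ descending n k @ v, a @ descending n j) \<in> lenlex less_than \<Longrightarrow>
        lin_ext (\<lambda>w. \<psi> (u @ w @ v)) (env_rel n k) = 0"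
  have overlap: "i = 1" "j = n + 1" "a = [n + 1]" "b = [1]"
    using descending_overlap[OF i j eq a(1)] a(2) descending_props(1)[OF i] by simp_all
  have top: "a @ descending n j = rev [1..<n + 2]"
    using overlap descending_extend(2)[of n] by simp
  have less: "(w, a @ descending n j) \<in> lenlex less_than"
    if "mset w = mset [1..<n + 2]" "w \<noteq> rev [1..<n + 2]" for w
    unfolding top using that by (intro lenlex_below_descending) (simp_all add: sorted_wrt_rev del: upt_Suc)
  have mset_desc: "add_mset k (mset (descending n k)) = mset [1..<n + 2]" if "k \<in> {1..n + 1}" for k
  proof -
    have "set (k # descending n k) = set [1..<n + 2]"
      using descending_props(2)[OF that] that
      by (simp add: insert_absorb atLeastLessThanSuc_atLeastAtMost del: upt_Suc)
    moreover have "distinct (k # descending n k)"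
      using descending_props(2,4)[OF that] by simp
    ultimately have "mset (k # descending n k) = mset [1..<n + 2]"
      by (simp only: set_eq_iff_mset_eq_distinct distinct_upt)
    then show ?thesis
      by (simp del: upt_Suc)
  qed
  define L where "L k = lin_ext (\<lambda>w. \<psi> (k # w)) (env_rel n k)" for k
  define R where "R k = lin_ext (\<lambda>w. \<psi> (w @ [k])) (env_rel n k)" for k
  have L: "L k = 0" if k: "k \<in> {1..n + 1}" "k \<noteq> n + 1" for k
  proof -
    have "k # descending n k \<noteq> rev [1..<n + 2]"
      using k unfolding descending_extend(2)[symmetric] by simp
    then have "([k] @ descending n k @ [], a @ descending n j) \<in> lenlex less_than"
      using mset_desc[OF k(1)] by (intro less) (simp_all del: upt_Suc)
    from kill[OF k(1) this] show ?thesis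
      by (simp add: L_def)
  qed
  have R: "R k = 0" if k: "k \<in> {1..n + 1}" "k \<noteq> 1" for k
  proof -
    have "descending n k @ [k] \<noteq> rev [1..<n + 2]"
      using k unfolding descending_extend(1)[symmetric] by simp
    then have "([] @ descending n k @ [k], a @ descending n j) \<in> lenlex less_than"
      using mset_desc[OF k(1)] by (intro less) (simp_all del: upt_Suc)
    from kill[OF k(1) this] show ?thesis
      by (simp add: R_def)
  qed
  have commutator: "lin_ext \<psi> ((-1) ^ k * (gen k * env_rel n k - env_rel n k * gen k)) =
      (-1) ^ k * L k - (-1) ^ k * R k" for k
    unfolding lin_ext_sign lin_ext_diff by (simp add: lin_ext_mult gen_def L_def R_def right_diff_distrib)
  have "0 = lin_ext \<psi> (\<Sum>k = 1..n + 1. (-1) ^ k * (gen k * env_rel n k - env_rel n k * gen k))"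
    by (simp only: env_rel_commutators[OF assms(1)] lin_ext_0)
  also have "\<dots> = (\<Sum>k = 1..n + 1. (-1) ^ k * L k) - (\<Sum>k = 1..n + 1. (-1) ^ k * R k)"
    by (simp only: lin_ext_sum commutator sum_subtractf)
  also have "(\<Sum>k = 1..n + 1. (-1) ^ k * L k) = (\<Sum>k \<in> {n + 1}. (-1) ^ k * L k)"
    using L by (intro sum.mono_neutral_right) auto
  also have "(\<Sum>k = 1..n + 1. (-1) ^ k * R k) = (\<Sum>k \<in> {1}. (-1) ^ k * R k)"
    using R by (intro sum.mono_neutral_right) auto
  finally have "L (n + 1) = R 1"
    using assms(1) by simp
  then show "lin_ext (\<lambda>w. \<psi> (w @ b)) (env_rel n i) = lin_ext (\<lambda>w. \<psi> (a @ w)) (env_rel n j)"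
    by (simp add: overlap L_def R_def)
qed

text \<open>
  Quantifying over the contexts \<open>u\<close> and \<open>v\<close> makes the kernel of the functional closed
  under multiplication from both sides.
\<close>

lemma ideal_of_annihilated:
  fixes \<phi> :: "nat list \<Rightarrow> 'f::field"
  shows "ideal {p \<in> carrier (free_algebra m). \<forall>u v. lin_ext (\<lambda>w. \<phi> (u @ w @ v)) p = 0} (free_algebra m)"
    (is "ideal ?J _")
proof (rule idealI[OF ring_free_algebra])
  interpret ring "free_algebra m" by (rule ring_free_algebra)
  show "subgroup ?J (add_monoid (free_algebra m))"
  proof (rule add.subgroupI)
    show "?J \<noteq> {}"
      using carrier_0 by force
    fix p assume p: "p \<in> ?J"
    have "\<ominus>\<^bsub>free_algebra m\<^esub> p = - p"
      using p carrier_uminus by (intro minus_equality) auto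
    then show "\<ominus>\<^bsub>free_algebra m\<^esub> p \<in> ?J"
      using p carrier_uminus[of p m] by (simp add: lin_ext_uminus)
  qed (auto simp: lin_ext_add intro: carrier_add)
  fix p q :: "'f free_alg"
  assume p: "p \<in> ?J" and q: "q \<in> carrier (free_algebra m)"
  have "lin_ext (\<lambda>w. \<phi> (u @ w @ v)) (q * p) = lin_ext (\<lambda>x. 0) q" for u v
    unfolding lin_ext_mult using p by (intro lin_ext_cong) (simp flip: append_assoc)
  then show "q \<otimes>\<^bsub>free_algebra m\<^esub> p \<in> ?J"
    using p q by (simp add: carrier_mult lin_ext_def)
  have "lin_ext (\<lambda>w. \<phi> (u @ w @ v)) (p * q) = lin_ext (\<lambda>x. 0) q" for u v
    unfolding lin_ext_mult lin_ext_swap[of _ q p] using p by (intro lin_ext_cong) simp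
  then show "p \<otimes>\<^bsub>free_algebra m\<^esub> q \<in> ?J"
    using p q by (simp add: carrier_mult lin_ext_def)
qed

text \<open>
  Leading words have length $n \ge 2$, so single letters are irreducible and the diamond lemma gives a
  functional that kills the ideal and reads off the coefficient of \<open>gen j\<close>.
\<close>

lemma generators_independent:
  fixes c :: "nat \<Rightarrow> 'f::field"
  assumes "even n" "n \<ge> 2"
    and "(\<Sum>k = 1..n + 1. of_scalar (c k) * gen k) \<in> env_ideal n"
    and "j \<in> {1..n + 1}"
  shows "c j = 0"
proof -
  interpret word_rewriting "{1..n + 1}" "descending n" "env_rel n :: nat \<Rightarrow> 'f free_alg" "lenlex less_than"
    by (rule word_rewriting_env_rel[OF assms(1,2)])
  obtain \<phi> :: "nat list \<Rightarrow> 'f" where \<phi>: "\<And>w. \<not> reducible w \<Longrightarrow> \<phi> w = (if w = [j] then 1 else 0)"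
    and kill: "\<And>k u v. k \<in> {1..n + 1} \<Longrightarrow> lin_ext (\<lambda>w. \<phi> (u @ w @ v)) (env_rel n k) = 0"
    using diamond[of "\<lambda>w. if w = [j] then 1 else 0"] by metis
  let ?J = "{p \<in> carrier (free_algebra (n + 1)). \<forall>u v. lin_ext (\<lambda>w. \<phi> (u @ w @ v)) p = 0}"
  have "env_ideal n \<subseteq> ?J"
    unfolding env_ideal_def using kill carrier_env_rel
    by (intro ring.genideal_minimal[OF ring_free_algebra ideal_of_annihilated]) blast
  then have "lin_ext (\<lambda>w. \<phi> ([] @ w @ [])) (\<Sum>k = 1..n + 1. of_scalar (c k) * gen k) = 0"
    using assms(3) by blast
  then have "(\<Sum>k = 1..n + 1. c k * \<phi> [k]) = 0"
    by (simp add: lin_ext_sum of_scalar_def gen_def mult_single del: sum.cl_ivl_Suc)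
  also have "(\<Sum>k = 1..n + 1. c k * \<phi> [k]) = (\<Sum>k = 1..n + 1. if k = j then c k else 0)"
  proof (rule sum.cong[OF refl])
    fix k
    have "\<not> reducible [k]"
    proof
      assume "reducible [k]"
      then obtain a i b where i: "i \<in> {1..n + 1}" and eq: "[k] = a @ descending n i @ b"
        unfolding reducible_def by blast
      show False
        using arg_cong[OF eq, of length] descending_props(1)[OF i] assms(2) by simp
    qed
    then show "c k * \<phi> [k] = (if k = j then c k else 0)"
      by (simp add: \<phi>)
  qed
  finally show ?thesis
    using assms(4) by (simp del: sum.cl_ivl_Suc)
qed

theorem corollary4p3:
  fixes scale :: "'f::field \<Rightarrow> 'v::ab_group_add \<Rightarrow> 'v"
    and n :: nat and bracket :: "'v list \<Rightarrow> 'v" and e :: "nat \<Rightarrow> 'v"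
  assumes "n \<ge> 4" and "even n" and "CHAR('f) \<noteq> 2"
    and "L_algebra scale n bracket e"
  shows "inj (natural_map scale n e)"
proof (rule injI)
  interpret L_algebra scale n bracket e by (rule assms(4))
  interpret I: ideal "env_ideal n :: 'f free_alg set" "free_algebra (n + 1)" by (rule ideal_env_ideal)
  let ?B = "e ` {1..n + 1}"
  fix v w
  let ?p = "\<Sum>k = 1..n + 1. of_scalar (coordinate v k) * gen k"
  let ?q = "\<Sum>k = 1..n + 1. of_scalar (coordinate w k) * gen k"
  assume "natural_map scale n e v = natural_map scale n e w"
  then have "?p \<in> env_ideal n +>\<^bsub>free_algebra (n + 1)\<^esub> ?q"
    using I.a_rcos_self[OF natural_map_carrier_aux[of v]] by (simp only: natural_map_def)
  then have diff: "?p - ?q \<in> env_ideal n"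
    by (auto simp: a_r_coset_def')
  have "?p - ?q = (\<Sum>k = 1..n + 1. of_scalar (coordinate v k - coordinate w k) * gen k)"
    by (simp add: of_scalar_def single_diff left_diff_distrib sum_subtractf del: sum.cl_ivl_Suc)
  from diff[unfolded this] have "coordinate v k - coordinate w k = 0" if "k \<in> {1..n + 1}" for k
    using that assms(1) by (intro generators_independent[OF assms(2)]) simp_all
  then have "(\<Sum>b \<in> ?B. scale (representation ?B v b) b) = (\<Sum>b \<in> ?B. scale (representation ?B w b) b)"
    by (intro sum.cong refl) auto
  moreover have "(\<Sum>b \<in> ?B. scale (representation ?B x b) b) = x" for x
    using basis_span by (intro sum_representation_eq[OF basis_independent]) auto
  ultimately show "v = w"
    by simp
qed

end
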